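(* Let $k,r\ge 1$ and let $$A=\begin{pmatrix}A_1&B\\ B^*&A_2\end{pmatrix}$$ be a Hermitian $(k+r)\times(k+r)$ complex matrix, written in blocks with respect to $\mathbb{C}^{k}\oplus\mathbb{C}^{r}$ (so $A_1$ is $k\times k$, $A_2$ is $r\times r$ and $B$ is $k\times r$). Then $$2\,s(B)\prec_w \mathrm{Spr}^+(A).$$
   Context: For a Hermitian $n\times n$ complex matrix $A$, $\lambda(A)=(\lambda_1(A),\dots,\lambda_n(A))$ denotes its eigenvalues, counted with multiplicity, in non-increasing order, and $\lambda^{\uparrow}(A)$ the same eigenvalues in non-decreasing order, so $\lambda^{\uparrow}_i(A)=\lambda_{n-i+1}(A)$. The spectral spread of $A$ is the vector $\mathrm{Spr}^+(A)=(\lambda_i(A)-\lambda_{n-i+1}(A))_{1\le i\le [n/2]}\in\mathbb{R}_{\ge 0}^{[n/2]}$, where $[\cdot]$ is the integer part. For a $k\times r$ complex matrix $B$, $s(B)=\lambda((B^*B)^{1/2})\in\mathbb{R}_{\ge0}^r$ is the vector of singular values in non-increasing order. Submajorization: for $x,y\in\mathbb{R}^m$, $x\prec_w y$ means $\sum_{i=1}^j x_i^{\downarrow}\le\sum_{i=1}^j y_i^{\downarrow}$ for all $1\le j\le m$, where $x^{\downarrow}$ is the non-increasing rearrangement of $x$. If $x,y$ have non-negative entries and different lengths, $x\prec_w y$ means the relation holds after appending zeros to the shorter vector to equalize lengths. *)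

theory Defs
  imports "Jordan_Normal_Form.Schur_Decomposition"
begin

definition hermitian :: "complex mat \<Rightarrow> bool" where
  "hermitian A \<longleftrightarrow> mat_adjoint A = A"

definition pos_semidef :: "complex mat \<Rightarrow> bool" where
  "pos_semidef A \<longleftrightarrow>
     hermitian A \<and> (\<forall>v \<in> carrier_vec (dim_row A). Re ((A *\<^sub>v v) \<bullet>c v) \<ge> 0)"

(* Meant for positive semidefinite M, where the positive semidefinite square root
   exists and is unique. *)
definition psd_sqrt :: "complex mat \<Rightarrow> complex mat" where
  "psd_sqrt M = (THE P. pos_semidef P \<and> P * P = M)"

(* Meant for hermitian A: the roots of the characteristic polynomial, taken with
   multiplicity, are then real (hermitian_proots_real below), so Re only changes the type.
   Lists are 0-based: the i-th largest eigenvalue is eigvals_desc A ! (i - 1). *)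
definition eigvals_desc :: "complex mat \<Rightarrow> real list" where
  "eigvals_desc A = rev (sorted_list_of_multiset (image_mset Re (proots (char_poly A))))"

(* Entry i (0-based) is \<lambda>_(i+1) - \<lambda>_(n-i) for the 1-based non-increasing eigenvalues. *)
definition spectral_spread :: "complex mat \<Rightarrow> real list" where
  "spectral_spread A =
     (let n = dim_row A; l = eigvals_desc A
      in map (\<lambda>i. l ! i - l ! (n - 1 - i)) [0..<n div 2])"

definition singular_values :: "complex mat \<Rightarrow> real list" where
  "singular_values B = eigvals_desc (psd_sqrt (mat_adjoint B * B))"

definition pad_zeros :: "nat \<Rightarrow> real list \<Rightarrow> real list" where
  "pad_zeros m x = x @ replicate (m - length x) 0"

(* Padding is vacuous for lists of equal length; for different lengths the notion is
   meant for non-negative entries only. *)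
definition submajorized :: "real list \<Rightarrow> real list \<Rightarrow> bool" (infix "\<prec>\<^sub>w" 50) where
  "x \<prec>\<^sub>w y \<longleftrightarrow>
     (let m = max (length x) (length y);
          x' = rev (sort (pad_zeros m x));
          y' = rev (sort (pad_zeros m y))
      in \<forall>j. 1 \<le> j \<and> j \<le> m \<longrightarrow> (\<Sum>i<j. x' ! i) \<le> (\<Sum>i<j. y' ! i))"

lemma mat_adjoint_index:
  assumes "i < dim_col A" "j < dim_row A"
  shows "mat_adjoint A $$ (i, j) = conjugate (A $$ (j, i))"
  using assms by (simp add: mat_adjoint_def mat_of_rows_def)

lemma length_eigvals_desc:
  assumes "A \<in> carrier_mat n n"
  shows "length (eigvals_desc A) = n"
proof -
  have "length (sorted_list_of_multiset M) = size M" for M :: "real multiset"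
    by (metis mset_sorted_list_of_multiset size_mset)
  then show ?thesis
    using degree_monic_char_poly[OF assms]
    by (simp add: eigvals_desc_def size_proots_complex)
qed

lemma hermitian_proots_real:
  assumes A: "A \<in> carrier_mat n n" and h: "hermitian A"
    and z: "z \<in># proots (char_poly A)"
  shows "z \<in> \<real>"
proof -
  have "char_poly A \<noteq> 0"
    using degree_monic_char_poly[OF A] by auto
  with z have "eigenvalue A z"
    by (simp add: eigenvalue_root_char_poly[OF A])
  then obtain v where v: "v \<in> carrier_vec n" "v \<noteq> 0\<^sub>v n" and Av: "A *\<^sub>v v = z \<cdot>\<^sub>v v"
    using A by (auto simp: eigenvalue_def eigenvector_def)
  have entry: "cnj (A $$ (j, i)) = A $$ (i, j)" if "i < n" "j < n" for i j
    using mat_adjoint_index[of i A j] that A h by (simp add: hermitian_def)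
  have expand: "(A *\<^sub>v v) \<bullet>c v = (\<Sum>i<n. \<Sum>j<n. A $$ (i, j) * v $ j * cnj (v $ i))"
    using A v by (simp add: scalar_prod_def sum_distrib_right atLeast0LessThan)
  have "cnj ((A *\<^sub>v v) \<bullet>c v) = (\<Sum>i<n. \<Sum>j<n. A $$ (j, i) * cnj (v $ j) * v $ i)"
    unfolding expand by (simp add: entry)
  also have "\<dots> = (\<Sum>j<n. \<Sum>i<n. A $$ (j, i) * cnj (v $ j) * v $ i)"
    by (rule sum.swap)
  also have "\<dots> = (A *\<^sub>v v) \<bullet>c v"
    unfolding expand by (simp add: mult_ac)
  finally have "cnj (z * (v \<bullet>c v)) = z * (v \<bullet>c v)"
    using v by (simp add: Av)
  moreover have "cnj (v \<bullet>c v) = v \<bullet>c v"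
    using conjugate_square_ge_0_vec[of v] by (simp add: less_eq_complex_def complex_eq_iff)
  moreover have "v \<bullet>c v \<noteq> 0"
    using v by simp
  ultimately have "cnj z = z"
    by simp
  then show ?thesis
    by (simp add: Reals_cnj_iff)
qed

end

theory Submission
  imports Defs
begin

text \<open>
Let \<open>s\<^sub>1 \<ge> \<dots> \<ge> s\<^sub>p > 0\<close> be the largest \<open>p\<close> singular values of \<open>B\<close>, assumed positive, with orthonormal
right and left singular vectors \<open>f\<^sub>i\<close> and \<open>e\<^sub>i\<close>, so that \<open>\<langle>B f\<^sub>i, e\<^sub>i\<rangle> = s\<^sub>i\<close>. For either sign, the
vectors \<open>w\<^sub>i\<^sup>\<plusminus> = (e\<^sub>i, \<plusminus>f\<^sub>i) / \<surd>2\<close> are orthonormal in \<open>\<complex>\<^sup>k \<oplus> \<complex>\<^sup>r\<close>. In the quadratic form of \<open>A\<close> the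
diagonal blocks contribute the same amount for both signs, while the off-diagonal blocks contribute
\<open>\<plusminus>s\<^sub>i\<close>, hence
\<open>2 \<Sum>\<^sub>i s\<^sub>i = \<Sum>\<^sub>i \<langle>A w\<^sub>i\<^sup>+, w\<^sub>i\<^sup>+\<rangle> - \<Sum>\<^sub>i \<langle>A w\<^sub>i\<^sup>-, w\<^sub>i\<^sup>-\<rangle>\<close>.
By Ky Fan's principle (\<open>Ky_Fan_bounds\<close>) the first sum is at most the sum of the \<open>p\<close> largest
eigenvalues of \<open>A\<close>, and the second is at least the sum of the \<open>p\<close> smallest ones. Thus
\<open>2 \<Sum>\<^sub>i s\<^sub>i\<close> is at most the sum of the first \<open>p\<close> entries of the spread
(\<open>sum_singular_values_le_spread\<close>). As there are \<open>p\<close> orthonormal vectors in both \<open>\<complex>\<^sup>k\<close> and \<open>\<complex>\<^sup>r\<close>,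
\<open>p\<close> does not exceed the length \<open>[(k + r) / 2]\<close> of the spread. Initial sums that reach beyond the
positive singular values follow because the entries of the spread are non-negative
(\<open>submajorizedI\<close>).

Orthonormal systems are represented by the matrices of their columns, that is, by isometries, and sums
of quadratic forms by traces of compressions \<open>W\<^sup>* A W\<close>. The foundation is the spectral theorem with the
eigenvalues in prescribed order (\<open>hermitian_diagonalization\<close>); it also yields existence and uniqueness
of the positive semidefinite root of \<open>B\<^sup>* B\<close>, and from this the singular vectors
(\<open>singular_vectors\<close>).
\<close>

section \<open>Adjoints, real diagonal matrices and isometries\<close>

lemma dim_mat_adjoint [simp]:
  "dim_row (mat_adjoint A) = dim_col A" "dim_col (mat_adjoint A) = dim_row A"
  by (simp_all add: mat_adjoint_def)

lemma mat_adjoint_carrier [simp]: "A \<in> carrier_mat n m \<Longrightarrow> mat_adjoint A \<in> carrier_mat m n"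
  by (auto intro: carrier_matI)

lemma mat_adjoint_adjoint [simp]:
  fixes A :: "complex mat"
  shows "mat_adjoint (mat_adjoint A) = A"
  by (rule eq_matI) (simp_all add: mat_adjoint_index)

lemma mat_adjoint_one [simp]: "mat_adjoint (1\<^sub>m n :: complex mat) = 1\<^sub>m n"
  by (rule eq_matI) (simp_all add: mat_adjoint_index)

lemma mat_adjoint_zero [simp]: "mat_adjoint (0\<^sub>m n m :: complex mat) = 0\<^sub>m m n"
  by (rule eq_matI) (simp_all add: mat_adjoint_index)

lemma mat_adjoint_smult:
  fixes A :: "complex mat"
  shows "mat_adjoint (c \<cdot>\<^sub>m A) = cnj c \<cdot>\<^sub>m mat_adjoint A"
  by (rule eq_matI) (simp_all add: mat_adjoint_index)

lemma mat_adjoint_minus: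
  fixes A B :: "complex mat"
  assumes "dim_row A = dim_row B" "dim_col A = dim_col B"
  shows "mat_adjoint (A - B) = mat_adjoint A - mat_adjoint B"
  using assms by (intro eq_matI) (simp_all add: mat_adjoint_index)

lemma mat_adjoint_mult:
  fixes A B :: "complex mat"
  assumes "dim_col A = dim_row B"
  shows "mat_adjoint (A * B) = mat_adjoint B * mat_adjoint A"
  using assms
  by (intro eq_matI) (auto simp: mat_adjoint_index scalar_prod_def mult.commute intro!: sum.cong)

lemma mat_adjoint_four_block:
  fixes A B C D :: "complex mat"
  assumes "A \<in> carrier_mat n1 m1" "B \<in> carrier_mat n1 m2"
    and "C \<in> carrier_mat n2 m1" "D \<in> carrier_mat n2 m2"
  shows "mat_adjoint (four_block_mat A B C D)
       = four_block_mat (mat_adjoint A) (mat_adjoint C) (mat_adjoint B) (mat_adjoint D)"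
  using assms by (intro eq_matI) (auto simp: mat_adjoint_index)

text \<open>Associativity and the cancellation law below are stated through dimensions instead of carriers, since
the rewriter can then discharge their side conditions for nested products.\<close>

lemma mult_mat_assoc:
  fixes A B C :: "complex mat"
  assumes "dim_col A = dim_row B" "dim_col B = dim_row C"
  shows "A * B * C = A * (B * C)"
  using assms by (intro assoc_mult_mat[of _ "dim_row A" "dim_row B" _ "dim_row C" _ "dim_col C"])
     (auto intro: carrier_matI)

lemma mult_mat_cancel_left:
  fixes A B C :: "complex mat"
  assumes "A * B = 1\<^sub>m n" "dim_col A = dim_row B" "dim_col B = n" "dim_row C = n"
  shows "A * (B * C) = C"
  using assms mult_mat_assoc[of A B C] by (metis left_mult_one_mat carrier_mat_triv)

lemma smult_mult_mat:
  fixes A B :: "complex mat"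
  assumes "dim_col A = dim_row B"
  shows "(c \<cdot>\<^sub>m A) * B = c \<cdot>\<^sub>m (A * B)" "A * (c \<cdot>\<^sub>m B) = c \<cdot>\<^sub>m (A * B)"
  using assms
  by (auto intro!: mult_smult_assoc_mat[of _ "dim_row A" "dim_row B" _ "dim_col B"]
      mult_smult_distrib[of _ "dim_row A" "dim_row B" _ "dim_col B"] carrier_matI)

lemma adjoint_mult_index:
  fixes X Y :: "complex mat"
  assumes "i < dim_col X" "j < dim_col Y" "dim_row X = dim_row Y"
  shows "(mat_adjoint X * Y) $$ (i, j) = (\<Sum>l<dim_row X. cnj (X $$ (l, i)) * Y $$ (l, j))"
  using assms
  by (auto simp: scalar_prod_def mat_adjoint_index atLeast0LessThan intro!: sum.cong)

definition real_diag :: "nat \<Rightarrow> (nat \<Rightarrow> real) \<Rightarrow> complex mat" where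
  "real_diag n f = mat n n (\<lambda>(i, j). if i = j then complex_of_real (f i) else 0)"

lemma real_diag_carrier [simp]: "real_diag n f \<in> carrier_mat n n"
  by (simp add: real_diag_def)

lemma dim_real_diag [simp]: "dim_row (real_diag n f) = n" "dim_col (real_diag n f) = n"
  by (simp_all add: real_diag_def)

lemma real_diag_index [simp]:
  "i < n \<Longrightarrow> j < n \<Longrightarrow> real_diag n f $$ (i, j) = (if i = j then complex_of_real (f i) else 0)"
  by (simp add: real_diag_def)

lemma mat_adjoint_real_diag [simp]: "mat_adjoint (real_diag n f) = real_diag n f"
  by (rule eq_matI) (simp_all add: mat_adjoint_index)

lemma real_diag_mult_index:
  assumes "dim_row X = n" "i < n" "j < dim_col X"
  shows "(real_diag n f * X) $$ (i, j) = of_real (f i) * X $$ (i, j)"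
proof -
  have "(real_diag n f * X) $$ (i, j)
      = (\<Sum>l<n. (if i = l then of_real (f i) else 0) * X $$ (l, j))"
    using assms by (simp add: scalar_prod_def atLeast0LessThan)
  also have "\<dots> = (\<Sum>l<n. (if l = i then of_real (f i) * X $$ (i, j) else 0))"
    by (intro sum.cong) auto
  finally have "(real_diag n f * X) $$ (i, j)
      = (\<Sum>l<n. (if l = i then of_real (f i) * X $$ (i, j) else 0))" .
  then show ?thesis
    using assms by simp
qed

lemma mult_real_diag_index:
  assumes "dim_col X = n" "i < dim_row X" "j < n"
  shows "(X * real_diag n f) $$ (i, j) = X $$ (i, j) * of_real (f j)"
proof -
  have "(X * real_diag n f) $$ (i, j)
      = (\<Sum>l<n. X $$ (i, l) * (if l = j then of_real (f l) else 0))"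
    using assms by (simp add: scalar_prod_def atLeast0LessThan)
  also have "\<dots> = (\<Sum>l<n. (if l = j then X $$ (i, j) * of_real (f j) else 0))"
    by (intro sum.cong) auto
  finally have "(X * real_diag n f) $$ (i, j)
      = (\<Sum>l<n. (if l = j then X $$ (i, j) * of_real (f j) else 0))" .
  then show ?thesis
    using assms by simp
qed

lemma real_diag_mult: "real_diag n f * real_diag n g = real_diag n (\<lambda>i. f i * g i)"
  by (rule eq_matI) (simp_all add: real_diag_mult_index del: index_mult_mat(1))

lemma real_diag_cong: "(\<And>i. i < n \<Longrightarrow> f i = g i) \<Longrightarrow> real_diag n f = real_diag n g"
  by (rule eq_matI) simp_all

lemma real_diag_one: "real_diag n (\<lambda>_. 1) = 1\<^sub>m n"
  by (rule eq_matI) simp_all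

text \<open>Isometries encode orthonormal systems: \<open>W\<close> is an isometry iff its \<open>p\<close> columns are orthonormal
vectors of \<open>\<complex>\<^sup>n\<close>. For \<open>p = n\<close> these are the unitary matrices.\<close>

definition isometry_mat :: "nat \<Rightarrow> nat \<Rightarrow> complex mat \<Rightarrow> bool" where
  "isometry_mat n p W \<longleftrightarrow> W \<in> carrier_mat n p \<and> mat_adjoint W * W = 1\<^sub>m p"

lemma isometry_matD:
  assumes "isometry_mat n p W"
  shows "W \<in> carrier_mat n p" "dim_row W = n" "dim_col W = p" "mat_adjoint W * W = 1\<^sub>m p"
  using assms by (auto simp: isometry_mat_def)

lemma unitary_right_inverse:
  assumes "isometry_mat n n U"
  shows "U * mat_adjoint U = 1\<^sub>m n"
  using mat_mult_left_right_inverse[of "mat_adjoint U" n U] assms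
  by (simp add: isometry_mat_def)

lemma isometry_mat_mult:
  assumes "isometry_mat n p V" "isometry_mat p q W"
  shows "isometry_mat n q (V * W)"
proof -
  note V = isometry_matD[OF assms(1)] and W = isometry_matD[OF assms(2)]
  have "mat_adjoint (V * W) * (V * W) = mat_adjoint W * (mat_adjoint V * (V * W))"
    using V(1-3) W(1-3) by (simp add: mat_adjoint_mult mult_mat_assoc)
  also have "mat_adjoint V * (V * W) = W"
    using V W by (intro mult_mat_cancel_left) auto
  finally show ?thesis
    using V W by (simp add: isometry_mat_def)
qed

lemma unitary_adjoint:
  assumes "isometry_mat n n U"
  shows "isometry_mat n n (mat_adjoint U)"
  using assms unitary_right_inverse[OF assms] by (simp add: isometry_mat_def)

lemma hermitian_conj:
  assumes "hermitian A" "dim_row A = dim_row X"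
  shows "hermitian (mat_adjoint X * A * X)"
proof -
  have "dim_col A = dim_row A"
    using assms(1) dim_mat_adjoint(2)[of A] by (simp add: hermitian_def)
  then show ?thesis
    using assms by (simp add: hermitian_def mat_adjoint_mult mult_mat_assoc)
qed

section \<open>The spectral theorem for Hermitian matrices\<close>

text \<open>Complete \<open>v\<close> to a basis, orthogonalise by Gram--Schmidt, which leaves the first vector unchanged, and
normalise the columns.\<close>

lemma unitary_with_first_column:
  fixes v :: "complex vec"
  assumes v: "v \<in> carrier_vec n" and v0: "v \<noteq> 0\<^sub>v n"
  shows "\<exists>W c. isometry_mat n n W \<and> col W 0 = c \<cdot>\<^sub>v v"
proof -
  interpret cof_vec_space n "TYPE(complex)" .
  define b where "b = basis_completion v"
  define ws where "ws = gram_schmidt n b"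
  note bc = basis_completion[OF v v0, folded b_def]
  have n0: "0 < n"
    using v v0 by (cases n) auto
  obtain vs where bv: "b = v # vs"
    using bc(6,7) n0 by (cases b) auto
  note gs = gram_schmidt_result[OF bc(2,4,5) refl, folded ws_def]
  have len: "length ws = n"
    using gs(4) bc(6) by simp
  have hd: "ws ! 0 = v"
    using gram_schmidt_hd[OF v, of vs] len n0 unfolding ws_def bv
    by (metis hd_conv_nth length_0_conv less_numeral_extra(3))
  have wc: "ws ! i \<in> carrier_vec n" if "i < n" for i
    using gs(3) len that by auto
  define c where "c i = complex_of_real (1 / sqrt (Re (ws ! i \<bullet>c ws ! i)))" for i
  define W where "W = mat n n (\<lambda>(a, i). c i * ws ! i $ a)"
  have orth: "ws ! i \<bullet>c ws ! j = 0 \<longleftrightarrow> i \<noteq> j" if "i < n" "j < n" for i j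
    using corthogonalD[OF gs(2)] that len by simp
  have norm: "c i * c i * (ws ! i \<bullet>c ws ! i) = 1" if "i < n" for i
  proof -
    have "ws ! i \<bullet>c ws ! i \<ge> 0"
      using wc[OF that] by (intro conjugate_square_ge_0_vec)
    then have re: "ws ! i \<bullet>c ws ! i = of_real (Re (ws ! i \<bullet>c ws ! i))"
      and "Re (ws ! i \<bullet>c ws ! i) \<ge> 0"
      by (auto simp: less_eq_complex_def complex_eq_iff)
    moreover have "Re (ws ! i \<bullet>c ws ! i) \<noteq> 0"
      using orth[OF that that] re by fastforce
    ultimately have "c i * c i = of_real (1 / Re (ws ! i \<bullet>c ws ! i))"
      by (simp add: c_def flip: of_real_mult)
    then show ?thesis
      using \<open>Re _ \<noteq> 0\<close> by (subst re) (simp flip: of_real_mult)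
  qed
  have "mat_adjoint W * W = 1\<^sub>m n"
  proof (rule eq_matI)
    fix i j assume "i < dim_row (1\<^sub>m n)" "j < dim_col (1\<^sub>m n)"
    then have ij: "i < n" "j < n" by auto
    have "(mat_adjoint W * W) $$ (i, j) = (\<Sum>l<n. cnj (W $$ (l, i)) * W $$ (l, j))"
      using ij by (subst adjoint_mult_index) (auto simp: W_def)
    also have "\<dots> = c i * c j * (ws ! j \<bullet>c ws ! i)"
      using ij wc[of i] wc[of j]
      by (auto simp: W_def scalar_prod_def atLeast0LessThan sum_distrib_left c_def intro!: sum.cong)
    also have "\<dots> = 1\<^sub>m n $$ (i, j)"
      using ij norm[of i] orth[of j i] by auto
    finally show "(mat_adjoint W * W) $$ (i, j) = 1\<^sub>m n $$ (i, j)" .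
  qed (auto simp: W_def)
  then have "isometry_mat n n W"
    by (simp add: isometry_mat_def W_def)
  moreover have "col W 0 = c 0 \<cdot>\<^sub>v v"
    using n0 v hd by (intro eq_vecI) (auto simp: W_def)
  ultimately show ?thesis by blast
qed

text \<open>Deflation: choose a unitary \<open>W\<close> whose first column is an eigenvector for the first listed root \<open>e\<close>.
The first column of \<open>W\<^sup>* A W\<close> is then \<open>e\<close> times a unit vector, hence so is its first row as the matrix is
Hermitian, and the remaining block is Hermitian with the remaining roots as its characteristic roots.
Because roots are split off in the order of the list, the diagonal carries the eigenvalues in any
prescribed order, in particular in non-increasing order.\<close>

theorem hermitian_diagonalization:
  fixes A :: "complex mat"
  assumes "A \<in> carrier_mat n n" "hermitian A"
    and "char_poly A = (\<Prod>e\<leftarrow>es. [:- complex_of_real e, 1:])"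
  shows "\<exists>U. isometry_mat n n U \<and> mat_adjoint U * A * U = real_diag n ((!) es)"
  using assms
proof (induction es arbitrary: n A)
  case Nil
  then have "n = 0"
    using degree_monic_char_poly[of A n] by simp
  then show ?case
    using Nil by (intro exI[of _ "1\<^sub>m 0"]) (auto simp: isometry_mat_def intro!: eq_matI)
next
  case (Cons e es)
  note A = Cons.prems(1) and h = Cons.prems(2) and cp = Cons.prems(3)
  have "eigenvalue A (of_real e)"
    unfolding eigenvalue_root_char_poly[OF A] cp by simp
  then obtain v where v: "v \<in> carrier_vec n" "v \<noteq> 0\<^sub>v n" and Av: "A *\<^sub>v v = of_real e \<cdot>\<^sub>v v"
    using A by (auto simp: eigenvalue_def eigenvector_def)
  obtain W c where W: "isometry_mat n n W" and col: "col W 0 = c \<cdot>\<^sub>v v"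
    using unitary_with_first_column[OF v] by blast
  note Wd = isometry_matD[OF W]
  obtain m where n: "n = Suc m"
    using v by (cases n) auto
  define A' where "A' = mat_adjoint W * A * W"
  have A': "A' \<in> carrier_mat n n"
    using A Wd by (auto simp: A'_def)
  have hA': "hermitian A'"
    unfolding A'_def using h A Wd by (intro hermitian_conj) auto
  have "similar_mat_wit A' A (mat_adjoint W) W"
    using A A' Wd unitary_right_inverse[OF W] by (intro similar_mat_witI[of _ _ n]) (auto simp: A'_def)
  then have cpA': "char_poly A' = char_poly A"
    by (intro char_poly_similar) (auto simp: similar_mat_def)
  have AW0: "col (A * W) 0 = of_real e \<cdot>\<^sub>v col W 0"
  proof -
    have "col (A * W) 0 = A *\<^sub>v col W 0"
      using A Wd n by (intro col_mult2[of _ n n _ n]) auto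
    also have "\<dots> = c \<cdot>\<^sub>v (A *\<^sub>v v)"
      unfolding col using A v by (intro mult_mat_vec) auto
    also have "\<dots> = of_real e \<cdot>\<^sub>v col W 0"
      unfolding col Av by (simp add: smult_smult_assoc mult.commute)
    finally show ?thesis .
  qed
  have col0: "A' $$ (i, 0) = (if i = 0 then of_real e else 0)" if "i < n" for i
  proof -
    have "A' = mat_adjoint W * (A * W)"
      using A Wd by (simp add: A'_def mult_mat_assoc)
    then have "A' $$ (i, 0) = row (mat_adjoint W) i \<bullet> (of_real e \<cdot>\<^sub>v col W 0)"
      using A Wd n that AW0 by simp
    also have "\<dots> = of_real e * (mat_adjoint W * W) $$ (i, 0)"
      using Wd(1-3) n that by simp
    also have "\<dots> = of_real e * 1\<^sub>m n $$ (i, 0)"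
      using Wd by simp
    finally show ?thesis
      using that n by auto
  qed
  have row0: "A' $$ (0, i) = (if i = 0 then of_real e else 0)" if "i < n" for i
    using hA' mat_adjoint_index[of 0 A' i] col0[OF that] A' that n
    by (auto simp: hermitian_def split: if_splits)
  define A3 where "A3 = mat m m (\<lambda>(i, j). A' $$ (Suc i, Suc j))"
  let ?E = "mat 1 1 (\<lambda>_. complex_of_real e)"
  have A3: "A3 \<in> carrier_mat m m"
    by (simp add: A3_def)
  have block: "A' = four_block_mat ?E (0\<^sub>m 1 m) (0\<^sub>m m 1) A3"
  proof (rule eq_matI)
    fix i j assume "i < dim_row (four_block_mat ?E (0\<^sub>m 1 m) (0\<^sub>m m 1) A3)"
      "j < dim_col (four_block_mat ?E (0\<^sub>m 1 m) (0\<^sub>m m 1) A3)"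
    then have "i < n" "j < n" using n A3 by auto
    then show "A' $$ (i, j) = four_block_mat ?E (0\<^sub>m 1 m) (0\<^sub>m m 1) A3 $$ (i, j)"
      using n A3 col0[of i] row0[of j] by (cases i; cases j) (auto simp: A3_def)
  qed (use n A' A3 in auto)
  have "hermitian A3"
    using hA' A' n
    by (auto simp: hermitian_def A3_def mat_adjoint_index intro!: eq_matI)
       (metis Suc_less_eq carrier_matD complex_cnj_cnj conjugate_complex_def mat_adjoint_index)
  have "char_poly A' = char_poly ?E * char_poly A3"
    unfolding block by (rule char_poly_four_block_zeros_col) (use A3 in auto)
  also have "char_poly ?E = [:- of_real e, 1:]"
    by (simp add: char_poly_defs det_def sign_def)
  finally have "char_poly A3 = (\<Prod>e\<leftarrow>es. [:- complex_of_real e, 1:])"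
    unfolding cpA' cp by (simp del: mult_pCons_left)
  from Cons.IH[OF A3 \<open>hermitian A3\<close> this]
  obtain U where U: "isometry_mat m m U" and D: "mat_adjoint U * A3 * U = real_diag m ((!) es)"
    by blast
  note Ud = isometry_matD[OF U]
  define F where "F = four_block_mat (1\<^sub>m 1) (0\<^sub>m 1 m) (0\<^sub>m m 1) U"
  have F_adj: "mat_adjoint F = four_block_mat (1\<^sub>m 1) (0\<^sub>m 1 m) (0\<^sub>m m 1) (mat_adjoint U)"
    unfolding F_def using Ud by (subst mat_adjoint_four_block) auto
  have F: "F \<in> carrier_mat n n"
    using Ud n by (auto simp: F_def)
  have "mat_adjoint F * F = 1\<^sub>m n"
    unfolding F_adj unfolding F_def n using Ud
    by (subst mult_four_block_mat[of _ 1 1 _ m _ m _ _ 1 _ m]) (auto simp: four_block_one_mat[of 1 m, simplified])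
  then have iF: "isometry_mat n n F"
    using F by (simp add: isometry_mat_def)
  have UA: "mat_adjoint U * A3 \<in> carrier_mat m m" "mat_adjoint U * A3 * U \<in> carrier_mat m m"
    using Ud A3 by auto
  have "mat_adjoint F * A' * F = four_block_mat ?E (0\<^sub>m 1 m) (0\<^sub>m m 1) (mat_adjoint U * A3 * U)"
    unfolding F_adj block unfolding F_def using Ud A3 UA
    by (subst mult_four_block_mat[of _ 1 1 _ m _ m _ _ 1 _ m];
        (subst mult_four_block_mat[of _ 1 1 _ m _ m _ _ 1 _ m])?) auto
  also have "\<dots> = real_diag n ((!) (e # es))"
    unfolding D n by (intro eq_matI) (auto simp: nth_Cons')
  finally have "mat_adjoint F * A' * F = real_diag n ((!) (e # es))" .
  then have "mat_adjoint (W * F) * A * (W * F) = real_diag n ((!) (e # es))"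
    using A Wd F by (simp add: A'_def mat_adjoint_mult mult_mat_assoc)
  then show ?case
    using isometry_mat_mult[OF W iF] by blast
qed

text \<open>Nothing is lost by taking real parts of the roots, as they are real.\<close>

lemma char_poly_eigvals_desc:
  assumes A: "A \<in> carrier_mat n n" and h: "hermitian A"
  shows "char_poly A = (\<Prod>e\<leftarrow>eigvals_desc A. [:- complex_of_real e, 1:])"
proof -
  let ?M = "proots (char_poly A)"
  have "char_poly A = (\<Prod>x\<in>#?M. [:- x, 1:])"
    using complex_poly_decompose_multiset[of "char_poly A"] degree_monic_char_poly[OF A] by simp
  also have "?M = image_mset (\<lambda>z. complex_of_real (Re z)) ?M"
  proof -
    have "image_mset (\<lambda>z. complex_of_real (Re z)) ?M = image_mset id ?M"
      by (intro image_mset_cong) (use hermitian_proots_real[OF A h] in auto)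
    then show ?thesis by simp
  qed
  also have "\<dots> = image_mset complex_of_real (mset (eigvals_desc A))"
    by (simp add: eigvals_desc_def multiset.map_comp comp_def)
  also have "(\<Prod>x\<in>#\<dots>. [:- x, 1:]) = (\<Prod>e\<leftarrow>eigvals_desc A. [:- complex_of_real e, 1:])"
    by (simp add: multiset.map_comp comp_def flip: mset_map prod_mset_prod_list)
  finally show ?thesis .
qed

lemma eigvals_desc_antimono:
  assumes "i \<le> j" "j < length (eigvals_desc A)"
  shows "eigvals_desc A ! j \<le> eigvals_desc A ! i"
proof -
  let ?xs = "sorted_list_of_multiset (image_mset Re (proots (char_poly A)))"
  have "sorted ?xs" by simp
  then show ?thesis
    using assms by (auto simp: eigvals_desc_def rev_nth intro!: sorted_nth_mono)
qed

lemma hermitian_eigvals_diagonalization: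
  assumes "A \<in> carrier_mat n n" "hermitian A"
  obtains U where "isometry_mat n n U"
    "mat_adjoint U * A * U = real_diag n ((!) (eigvals_desc A))"
  using hermitian_diagonalization[OF assms char_poly_eigvals_desc[OF assms]] by blast

lemma unitary_conj_eq:
  assumes "isometry_mat n n U" "A \<in> carrier_mat n n" "mat_adjoint U * A * U = D"
  shows "A = U * D * mat_adjoint U"
proof -
  note U = isometry_matD(1-3)[OF assms(1)]
  have r: "U * mat_adjoint U = 1\<^sub>m n"
    by (rule unitary_right_inverse[OF assms(1)])
  have "U * D * mat_adjoint U = U * (mat_adjoint U * (A * (U * mat_adjoint U)))"
    using U assms(2) by (simp add: mult_mat_assoc flip: assms(3))
  also have "\<dots> = A"
    unfolding r using U assms(2) r by (subst mult_mat_cancel_left) auto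
  finally show ?thesis by simp
qed

section \<open>Ky Fan's bounds for the trace of a compression\<close>

lemma conj_real_diag_index:
  assumes "dim_row X = n" "i < dim_col X" "j < dim_col X"
  shows "(mat_adjoint X * (real_diag n d * X)) $$ (i, j)
       = (\<Sum>l<n. of_real (d l) * (cnj (X $$ (l, i)) * X $$ (l, j)))"
proof -
  have "(mat_adjoint X * (real_diag n d * X)) $$ (i, j)
      = (\<Sum>l<n. cnj (X $$ (l, i)) * (real_diag n d * X) $$ (l, j))"
    using assms by (subst adjoint_mult_index) auto
  also have "\<dots> = (\<Sum>l<n. of_real (d l) * (cnj (X $$ (l, i)) * X $$ (l, j)))"
    using assms by (intro sum.cong) (simp_all add: real_diag_mult_index del: index_mult_mat(1))
  finally show ?thesis .
qed

lemma conj_real_diag_diag: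
  assumes "dim_row X = n" "i < dim_col X"
  shows "(mat_adjoint X * (real_diag n d * X)) $$ (i, i)
       = of_real (\<Sum>l<n. d l * (cmod (X $$ (l, i)))\<^sup>2)"
  using assms
  by (simp add: conj_real_diag_index complex_norm_square mult.commute[of "cnj _"]
      del: of_real_power index_mult_mat(1))

text \<open>Bessel's inequality for a coordinate vector. The squared norm \<open>c\<close> of row \<open>l\<close> is a diagonal entry of
the projection \<open>Q = X X\<^sup>*\<close>, and \<open>Q = Q\<^sup>* Q\<close> shows \<open>c\<^sup>2 \<le> c\<close>: the entry \<open>c\<close> is one of the
entries whose squared moduli sum to \<open>c\<close>.\<close>

lemma row_norm_isometry_le_1:
  assumes "isometry_mat n p X" "l < n"
  shows "(\<Sum>i<p. (cmod (X $$ (l, i)))\<^sup>2) \<le> 1"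
proof -
  note X = isometry_matD[OF assms(1)]
  define c where "c = (\<Sum>i<p. (cmod (X $$ (l, i)))\<^sup>2)"
  define Q where "Q = X * mat_adjoint X"
  have Q: "dim_row Q = n" "dim_col Q = n"
    using X by (auto simp: Q_def)
  have "mat_adjoint Q * Q = X * (mat_adjoint X * (X * mat_adjoint X))"
    using X(1-3) by (simp add: Q_def mat_adjoint_mult mult_mat_assoc)
  also have "\<dots> = Q"
    unfolding Q_def using X by (subst mult_mat_cancel_left) auto
  finally have idem: "mat_adjoint Q * Q = Q" .
  have "Q $$ (l, l) = (\<Sum>i<p. X $$ (l, i) * cnj (X $$ (l, i)))"
    using X assms(2) by (auto simp: Q_def scalar_prod_def mat_adjoint_index atLeast0LessThan)
  then have Qll: "Q $$ (l, l) = of_real c"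
    by (simp add: c_def complex_norm_square del: of_real_power)
  have "of_real c = (mat_adjoint Q * Q) $$ (l, l)"
    by (simp only: idem Qll)
  also have "\<dots> = (\<Sum>m<n. cnj (Q $$ (m, l)) * Q $$ (m, l))"
    using Q assms(2) by (subst adjoint_mult_index) auto
  also have "\<dots> = of_real (\<Sum>m<n. (cmod (Q $$ (m, l)))\<^sup>2)"
    by (simp add: complex_norm_square mult.commute del: of_real_power)
  finally have "c = (\<Sum>m<n. (cmod (Q $$ (m, l)))\<^sup>2)"
    by (simp only: of_real_eq_iff)
  also have "\<dots> \<ge> (cmod (Q $$ (l, l)))\<^sup>2"
    using assms(2) by (intro member_le_sum) auto
  finally have "c\<^sup>2 \<le> c"
    by (simp add: Qll)
  then show ?thesis
    unfolding c_def[symmetric] by (cases "c \<le> 0") (auto simp: power2_eq_square)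
qed

lemma sum_norm_isometry:
  assumes "isometry_mat n p X"
  shows "(\<Sum>l<n. \<Sum>i<p. (cmod (X $$ (l, i)))\<^sup>2) = real p"
proof -
  note X = isometry_matD[OF assms]
  have one: "(\<Sum>l<n. (cmod (X $$ (l, i)))\<^sup>2) = 1" if "i < p" for i
  proof -
    have "of_real (\<Sum>l<n. (cmod (X $$ (l, i)))\<^sup>2) = (mat_adjoint X * X) $$ (i, i)"
      using X(1-3) that
      by (subst adjoint_mult_index)
         (auto simp: complex_norm_square mult.commute simp del: of_real_power)
    also have "\<dots> = of_real 1"
      using X that by simp
    finally show ?thesis
      by (simp only: of_real_eq_iff)
  qed
  show ?thesis
    by (subst sum.swap) (simp add: one)
qed

lemma isometry_dim_le:
  assumes "isometry_mat n p X"
  shows "p \<le> n"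
proof -
  have "real p \<le> (\<Sum>l<n. 1)"
    unfolding sum_norm_isometry[OF assms, symmetric]
    by (intro sum_mono row_norm_isometry_le_1[OF assms]) auto
  then show ?thesis by simp
qed

text \<open>Weights in \<open>[0, 1]\<close> of total mass \<open>p\<close> collect most when they fill the \<open>p\<close> largest values. The
comparison is made termwise after subtracting the threshold \<open>t = d (p - 1)\<close>: up to this index the
shifted values are non-negative and the weight is at most 1, beyond it they are non-positive.\<close>

lemma weighted_sum_le_top_sum:
  fixes d c :: "nat \<Rightarrow> real"
  assumes anti: "\<And>i j. i \<le> j \<Longrightarrow> j < n \<Longrightarrow> d j \<le> d i"
    and c: "\<And>l. l < n \<Longrightarrow> 0 \<le> c l" "\<And>l. l < n \<Longrightarrow> c l \<le> 1"
    and sum: "(\<Sum>l<n. c l) = real p" and p: "p \<le> n"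
  shows "(\<Sum>l<n. d l * c l) \<le> (\<Sum>l<p. d l)"
proof -
  \<comment> \<open>For \<open>p = 0\<close> truncated subtraction gives \<open>t = d 0\<close>, which is an upper bound of all values, as required.\<close>
  define t where "t = d (p - 1)"
  have "d l * c l \<le> (if l < p then d l - t else 0) + t * c l" if l: "l < n" for l
  proof (cases "l < p")
    case True
    then have "d l \<ge> t"
      unfolding t_def using p by (intro anti) auto
    then have "(d l - t) * c l \<le> (d l - t) * 1"
      using c[OF l] by (intro mult_left_mono) auto
    then show ?thesis
      using True by (simp add: algebra_simps)
  next
    case False
    then have "d l \<le> t"
      unfolding t_def using l by (intro anti) auto
    then show ?thesis
      using False c[OF l] by (simp add: mult_right_mono)
  qed
  then have "(\<Sum>l<n. d l * c l) \<le> (\<Sum>l<n. (if l < p then d l - t else 0) + t * c l)"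
    by (intro sum_mono) auto
  also have "\<dots> = (\<Sum>l<n. if l < p then d l - t else 0) + t * real p"
    by (simp add: sum.distrib sum flip: sum_distrib_left)
  also have "(\<Sum>l<n. if l < p then d l - t else 0) = (\<Sum>l<p. d l - t)"
    using p by (intro sum.mono_neutral_cong_right) auto
  finally show ?thesis
    by (simp add: sum_subtractf)
qed

text \<open>The mirror image, obtained by negating the values and reversing their order.\<close>

lemma bottom_sum_le_weighted_sum:
  fixes d c :: "nat \<Rightarrow> real"
  assumes anti: "\<And>i j. i \<le> j \<Longrightarrow> j < n \<Longrightarrow> d j \<le> d i"
    and c: "\<And>l. l < n \<Longrightarrow> 0 \<le> c l" "\<And>l. l < n \<Longrightarrow> c l \<le> 1"
    and sum: "(\<Sum>l<n. c l) = real p" and p: "p \<le> n"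
  shows "(\<Sum>l<p. d (n - 1 - l)) \<le> (\<Sum>l<n. d l * c l)"
proof -
  have "(\<Sum>l<n. - d (n - 1 - l) * c (n - 1 - l)) \<le> (\<Sum>l<p. - d (n - 1 - l))"
    using c p sum.nat_diff_reindex[of c n] sum
    by (intro weighted_sum_le_top_sum) (auto intro!: anti)
  then show ?thesis
    using sum.nat_diff_reindex[of "\<lambda>l. d l * c l" n] by (simp add: sum_negf)
qed

text \<open>In an eigenbasis of \<open>A\<close>, the trace of \<open>W\<^sup>* A W\<close> is a combination of the eigenvalues whose weights are
the squared row norms of an isometry. These lie in \<open>[0, 1]\<close> by Bessel's inequality and sum to \<open>p\<close>.\<close>

theorem Ky_Fan_bounds:
  assumes A: "A \<in> carrier_mat n n" "hermitian A" and W: "isometry_mat n p W"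
  defines "\<tau> \<equiv> \<Sum>i<p. Re ((mat_adjoint W * A * W) $$ (i, i))"
  shows "\<tau> \<le> (\<Sum>i<p. eigvals_desc A ! i)"
    and "(\<Sum>i<p. eigvals_desc A ! (n - 1 - i)) \<le> \<tau>"
proof -
  let ?d = "(!) (eigvals_desc A)"
  obtain U where U: "isometry_mat n n U" and D: "mat_adjoint U * A * U = real_diag n ?d"
    using hermitian_eigvals_diagonalization[OF A] by blast
  note Ud = isometry_matD(1-3)[OF U] and Wd = isometry_matD(1-3)[OF W]
  define X where "X = mat_adjoint U * W"
  have X: "isometry_mat n p X"
    unfolding X_def by (rule isometry_mat_mult[OF unitary_adjoint[OF U] W])
  note Xd = isometry_matD(1-3)[OF X]
  define c where "c l = (\<Sum>i<p. (cmod (X $$ (l, i)))\<^sup>2)" for l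
  have "mat_adjoint W * A * W = mat_adjoint X * (real_diag n ?d * X)"
    unfolding X_def by (subst unitary_conj_eq[OF U A(1) D])
      (use Ud Wd in \<open>simp add: mat_adjoint_mult mult_mat_assoc\<close>)
  then have "\<tau> = (\<Sum>i<p. \<Sum>l<n. ?d l * (cmod (X $$ (l, i)))\<^sup>2)"
    unfolding \<tau>_def using Xd by (simp add: conj_real_diag_diag del: index_mult_mat)
  also have "\<dots> = (\<Sum>l<n. ?d l * c l)"
    unfolding c_def by (subst sum.swap) (simp add: sum_distrib_left)
  finally have \<tau>: "\<tau> = (\<Sum>l<n. ?d l * c l)" .
  have anti: "?d j \<le> ?d i" if "i \<le> j" "j < n" for i j
    using eigvals_desc_antimono[OF that(1)] that(2) length_eigvals_desc[OF A(1)] by simp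
  have c: "0 \<le> c l" "c l \<le> 1" if "l < n" for l
    using row_norm_isometry_le_1[OF X that] by (auto simp: c_def intro: sum_nonneg)
  have sum: "(\<Sum>l<n. c l) = real p"
    unfolding c_def by (rule sum_norm_isometry[OF X])
  show "\<tau> \<le> (\<Sum>i<p. eigvals_desc A ! i)"
    unfolding \<tau> by (rule weighted_sum_le_top_sum[OF anti c sum isometry_dim_le[OF W]])
  show "(\<Sum>i<p. eigvals_desc A ! (n - 1 - i)) \<le> \<tau>"
    unfolding \<tau> by (rule bottom_sum_le_weighted_sum[OF anti c sum isometry_dim_le[OF W]])
qed

section \<open>Positive semidefinite square roots\<close>

lemma hermitian_square: "hermitian A \<Longrightarrow> dim_col A = dim_row A"
  using dim_mat_adjoint(2)[of A] by (simp add: hermitian_def)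

lemma conj_diag_eq_quadratic_form:
  fixes P X :: "complex mat"
  assumes "dim_col P = dim_row X" "dim_row P = dim_row X" "i < dim_col X"
  shows "(mat_adjoint X * P * X) $$ (i, i) = (P *\<^sub>v col X i) \<bullet>c col X i"
proof -
  have "(mat_adjoint X * P * X) $$ (i, i) = (mat_adjoint X * (P * X)) $$ (i, i)"
    using assms by (simp add: mult_mat_assoc)
  also have "\<dots> = (P *\<^sub>v col X i) \<bullet>c col X i"
    using assms
    by (auto simp: scalar_prod_def[of "row (mat_adjoint X) _"] scalar_prod_def[of "P *\<^sub>v _"]
        mat_adjoint_index intro!: sum.cong)
  finally show ?thesis .
qed

lemma pos_semidef_conj_diag:
  assumes "pos_semidef P" "dim_row P = dim_row X" "i < dim_col X"
  shows "0 \<le> Re ((mat_adjoint X * P * X) $$ (i, i))"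
proof -
  have "dim_col P = dim_row P"
    using assms(1) by (intro hermitian_square) (simp add: pos_semidef_def)
  then show ?thesis
    using assms by (subst conj_diag_eq_quadratic_form) (auto simp: pos_semidef_def)
qed

lemma pos_semidef_unitary_conj_real_diag:
  assumes V: "isometry_mat n n V" and f: "\<And>i. i < n \<Longrightarrow> 0 \<le> f i"
  shows "pos_semidef (V * real_diag n f * mat_adjoint V)"
proof -
  note Vd = isometry_matD(1-3)[OF V]
  let ?P = "V * real_diag n f * mat_adjoint V"
  have "0 \<le> Re ((?P *\<^sub>v v) \<bullet>c v)" if v: "v \<in> carrier_vec n" for v
  proof -
    \<comment> \<open>A quadratic form is a \<open>1 \<times> 1\<close> conjugation, so the formula for diagonal entries applies.\<close>
    define X where "X = mat_of_cols n [v]"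
    have X: "dim_row X = n" "dim_col X = 1" "col X 0 = v"
      using v by (auto simp: X_def)
    let ?Y = "mat_adjoint V * X"
    have "(?P *\<^sub>v v) \<bullet>c v = (mat_adjoint X * ?P * X) $$ (0, 0)"
      using Vd X by (subst conj_diag_eq_quadratic_form) auto
    also have "mat_adjoint X * ?P * X = mat_adjoint ?Y * (real_diag n f * ?Y)"
      using Vd X by (simp add: mat_adjoint_mult mult_mat_assoc)
    also have "\<dots> $$ (0, 0) = of_real (\<Sum>l<n. f l * (cmod (?Y $$ (l, 0)))\<^sup>2)"
      using Vd X by (intro conj_real_diag_diag) auto
    finally show ?thesis
      using f by (auto intro!: sum_nonneg simp del: index_mult_mat)
  qed
  then show ?thesis
    using Vd by (auto simp: pos_semidef_def hermitian_def mat_adjoint_mult mult_mat_assoc)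
qed

text \<open>Diagonalise \<open>P - Q\<close> and let \<open>P'\<close>, \<open>Q'\<close> be the two roots in the eigenbasis, so that
\<open>P' - Q' = diag t\<close>. From \<open>P'\<^sup>2 = Q'\<^sup>2\<close> follows \<open>P' (P' - Q') + (P' - Q') Q' = 0\<close>, whose diagonal
entries read \<open>t i * (P' i i + Q' i i) = 0\<close>. If the second factor vanishes then both of its
non-negative summands vanish, and again \<open>t i = P' i i - Q' i i = 0\<close>.\<close>

lemma pos_semidef_root_unique:
  assumes P: "pos_semidef P" and Q: "pos_semidef Q" and eq: "P * P = Q * Q"
  shows "P = Q"
proof -
  define n where "n = dim_row P"
  have hP: "hermitian P" and hQ: "hermitian Q"
    using P Q by (auto simp: pos_semidef_def)
  have dP: "dim_row P = n" "dim_col P = n"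
    using hermitian_square[OF hP] by (auto simp: n_def)
  have dQ: "dim_row Q = n" "dim_col Q = n"
    using hermitian_square[OF hQ] arg_cong[OF eq, of dim_row] dP by auto
  have PQ: "P - Q \<in> carrier_mat n n" "hermitian (P - Q)"
    using dP dQ hP hQ by (auto simp: hermitian_def mat_adjoint_minus)
  obtain U where U: "isometry_mat n n U"
    and D: "mat_adjoint U * (P - Q) * U = real_diag n ((!) (eigvals_desc (P - Q)))"
    using hermitian_eigvals_diagonalization[OF PQ] by blast
  define t where "t = (!) (eigvals_desc (P - Q))"
  note Ud = isometry_matD(1-3)[OF U]
  define P' where "P' = mat_adjoint U * P * U"
  define Q' where "Q' = mat_adjoint U * Q * U"
  have d': "dim_row P' = n" "dim_col P' = n" "dim_row Q' = n" "dim_col Q' = n"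
    using Ud by (auto simp: P'_def Q'_def)
  have cP: "P \<in> carrier_mat n n" "Q \<in> carrier_mat n n" "P' \<in> carrier_mat n n" "Q' \<in> carrier_mat n n"
    using dP dQ d' by auto
  have UPQ: "mat_adjoint U * P \<in> carrier_mat n n" "mat_adjoint U * Q \<in> carrier_mat n n"
    using Ud cP by auto
  have diff: "P' - Q' = real_diag n t"
    unfolding t_def D[symmetric] P'_def Q'_def using Ud cP UPQ
    by (simp add: mult_minus_distrib_mat[of _ n n _ n] minus_mult_distrib_mat[of _ n n _ _ n])
  have sq: "mat_adjoint U * Y * U * (mat_adjoint U * Y * U) = mat_adjoint U * (Y * Y) * U"
    if "dim_row Y = n" "dim_col Y = n" for Y
  proof -
    have "mat_adjoint U * Y * U * (mat_adjoint U * Y * U)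
        = mat_adjoint U * (Y * (U * (mat_adjoint U * (Y * U))))"
      using that Ud by (simp add: mult_mat_assoc)
    also have "U * (mat_adjoint U * (Y * U)) = Y * U"
      using that Ud unitary_right_inverse[OF U] by (intro mult_mat_cancel_left) auto
    finally show ?thesis
      using that Ud by (simp add: mult_mat_assoc)
  qed
  have "P' * P' = Q' * Q'"
    unfolding P'_def Q'_def using dP dQ eq by (simp add: sq)
  then have "P' * (P' - Q') + (P' - Q') * Q' = 0\<^sub>m n n"
    using cP by (simp add: mult_minus_distrib_mat[of _ n n _ n] minus_mult_distrib_mat[of _ n n _ _ n])
       (auto intro!: eq_matI)
  then have zero: "P' * real_diag n t + real_diag n t * Q' = 0\<^sub>m n n"
    by (simp add: diff)
  have t0: "t i = 0" if i: "i < n" for i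
  proof -
    have "(P' * real_diag n t) $$ (i, i) = P' $$ (i, i) * of_real (t i)"
      using i d' by (intro mult_real_diag_index) auto
    moreover have "(real_diag n t * Q') $$ (i, i) = of_real (t i) * Q' $$ (i, i)"
      using i d' by (intro real_diag_mult_index) auto
    moreover have "(P' * real_diag n t + real_diag n t * Q') $$ (i, i) = 0"
      using zero i by simp
    ultimately have "of_real (t i) * (P' $$ (i, i) + Q' $$ (i, i)) = 0"
      using i d' by (simp add: algebra_simps del: index_mult_mat(1))
    then have "t i = 0 \<or> Re (P' $$ (i, i)) + Re (Q' $$ (i, i)) = 0"
      by (auto simp flip: plus_complex.sel)
    moreover have "Re (P' $$ (i, i)) \<ge> 0" "Re (Q' $$ (i, i)) \<ge> 0"
      unfolding P'_def Q'_def using P Q dP dQ Ud i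
      by (auto intro!: pos_semidef_conj_diag simp del: index_mult_mat(1))
    moreover have "t i = Re (P' $$ (i, i)) - Re (Q' $$ (i, i))"
      using arg_cong[OF diff, of "\<lambda>M. Re (M $$ (i, i))"] d' i by simp
    ultimately show ?thesis by linarith
  qed
  have "P - Q = U * real_diag n t * mat_adjoint U"
    unfolding t_def by (rule unitary_conj_eq[OF U PQ(1) D])
  also have "real_diag n t = 0\<^sub>m n n"
    using t0 by (intro eq_matI) auto
  finally have "P - Q = 0\<^sub>m n n"
    using Ud by simp
  then have "(P - Q) $$ (i, j) = 0" if "i < n" "j < n" for i j
    using that by simp
  then show ?thesis
    using dP dQ by (intro eq_matI) auto
qed

text \<open>Diagonalise \<open>B\<^sup>* B\<close> and take square roots of the eigenvalues, which are squared norms of the columns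
of \<open>B V\<close>.\<close>

lemma pos_semidef_root_exists:
  assumes B: "B \<in> carrier_mat k r"
  shows "\<exists>P. pos_semidef P \<and> P * P = mat_adjoint B * B"
proof -
  let ?M = "mat_adjoint B * B"
  have M: "?M \<in> carrier_mat r r" "hermitian ?M"
    using B by (auto simp: hermitian_def mat_adjoint_mult)
  define d where "d = (!) (eigvals_desc ?M)"
  obtain V where V: "isometry_mat r r V" and D: "mat_adjoint V * ?M * V = real_diag r d"
    unfolding d_def using hermitian_eigvals_diagonalization[OF M] by blast
  note Vd = isometry_matD[OF V]
  have d: "0 \<le> d i" if i: "i < r" for i
  proof -
    have "mat_adjoint V * ?M * V = mat_adjoint (B * V) * (B * V)"
      using Vd(1-3) B by (simp add: mat_adjoint_mult mult_mat_assoc)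
    then have eq: "real_diag r d = mat_adjoint (B * V) * (B * V)"
      by (simp only: D)
    have "of_real (d i) = real_diag r d $$ (i, i)"
      using i by simp
    also have "\<dots> = (mat_adjoint (B * V) * (B * V)) $$ (i, i)"
      by (simp only: eq)
    also have "\<dots> = (\<Sum>l<k. cnj ((B * V) $$ (l, i)) * (B * V) $$ (l, i))"
      using Vd B i by (subst adjoint_mult_index) auto
    also have "\<dots> = of_real (\<Sum>l<k. (cmod ((B * V) $$ (l, i)))\<^sup>2)"
      by (simp add: complex_norm_square mult.commute del: of_real_power index_mult_mat)
    finally have "d i = (\<Sum>l<k. (cmod ((B * V) $$ (l, i)))\<^sup>2)"
      by (simp only: of_real_eq_iff)
    then show ?thesis
      by (simp add: sum_nonneg)
  qed
  let ?S = "real_diag r (\<lambda>i. sqrt (d i))"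
  define P where "P = V * ?S * mat_adjoint V"
  have "pos_semidef P"
    unfolding P_def using d by (intro pos_semidef_unitary_conj_real_diag[OF V]) auto
  moreover have "P * P = ?M"
  proof -
    have "P * P = V * (?S * (mat_adjoint V * (V * (?S * mat_adjoint V))))"
      using Vd(1-3) by (simp add: P_def mult_mat_assoc)
    also have "mat_adjoint V * (V * (?S * mat_adjoint V)) = ?S * mat_adjoint V"
      using Vd by (intro mult_mat_cancel_left) auto
    also have "V * (?S * (?S * mat_adjoint V)) = V * (?S * ?S) * mat_adjoint V"
      using Vd(1-3) by (simp add: mult_mat_assoc)
    also have "?S * ?S = real_diag r d"
      unfolding real_diag_mult using d by (intro real_diag_cong) auto
    also have "V * real_diag r d * mat_adjoint V = ?M"
      by (rule unitary_conj_eq[OF V M(1) D, symmetric])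
    finally show ?thesis .
  qed
  ultimately show ?thesis by blast
qed

text \<open>Existence and uniqueness of the root turn the definite description behind the square root into its
defining properties.\<close>

lemma psd_sqrt_gram:
  assumes "B \<in> carrier_mat k r"
  shows "pos_semidef (psd_sqrt (mat_adjoint B * B))"
    and "psd_sqrt (mat_adjoint B * B) * psd_sqrt (mat_adjoint B * B) = mat_adjoint B * B"
    and "psd_sqrt (mat_adjoint B * B) \<in> carrier_mat r r"
proof -
  let ?P = "psd_sqrt (mat_adjoint B * B)"
  have "\<exists>!P. pos_semidef P \<and> P * P = mat_adjoint B * B"
    using pos_semidef_root_exists[OF assms] pos_semidef_root_unique by (metis (no_types))
  then have *: "pos_semidef ?P \<and> ?P * ?P = mat_adjoint B * B"
    unfolding psd_sqrt_def by (rule theI')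
  then show "pos_semidef ?P" "?P * ?P = mat_adjoint B * B" by auto
  have "dim_row ?P = r"
    using arg_cong[OF conjunct2[OF *], of dim_row] assms by simp
  then show "?P \<in> carrier_mat r r"
    using * hermitian_square[of ?P] by (auto simp: pos_semidef_def)
qed

section \<open>Singular vectors\<close>

lemma singular_values_diagonalization:
  assumes "B \<in> carrier_mat k r"
  obtains V where "isometry_mat r r V"
    "mat_adjoint V * psd_sqrt (mat_adjoint B * B) * V = real_diag r ((!) (singular_values B))"
  unfolding singular_values_def
  using hermitian_eigvals_diagonalization[of "psd_sqrt (mat_adjoint B * B)" r] psd_sqrt_gram[OF assms]
  by (auto simp: pos_semidef_def)

lemma singular_values_nonneg:
  assumes B: "B \<in> carrier_mat k r" and i: "i < r"
  shows "0 \<le> singular_values B ! i"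
proof -
  obtain V where V: "isometry_mat r r V"
    and D: "mat_adjoint V * psd_sqrt (mat_adjoint B * B) * V = real_diag r ((!) (singular_values B))"
    using singular_values_diagonalization[OF B] by blast
  have "0 \<le> Re ((mat_adjoint V * psd_sqrt (mat_adjoint B * B) * V) $$ (i, i))"
    using isometry_matD[OF V] psd_sqrt_gram[OF B] i by (intro pos_semidef_conj_diag) auto
  then show ?thesis
    unfolding D using i by simp
qed

text \<open>Singular vectors for the first \<open>p\<close> singular values, provided that these are positive. The columns of
\<open>F\<close> are eigenvectors of \<open>(B\<^sup>* B)\<^sup>1\<^sup>/\<^sup>2\<close>, and those of \<open>E\<close> are their images under \<open>B\<close> divided by the
singular values; they are orthonormal because \<open>F\<^sup>* B\<^sup>* B F\<close> is diagonal with the squares of the singular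
values as entries.\<close>

theorem singular_vectors:
  assumes B: "B \<in> carrier_mat k r" and p: "p \<le> r"
    and pos: "\<And>i. i < p \<Longrightarrow> 0 < singular_values B ! i"
  obtains E F where "isometry_mat k p E" "isometry_mat r p F"
    "mat_adjoint E * B * F = real_diag p ((!) (singular_values B))"
proof -
  define P where "P = psd_sqrt (mat_adjoint B * B)"
  define s where "s = (!) (singular_values B)"
  obtain V where V: "isometry_mat r r V" and D: "mat_adjoint V * P * V = real_diag r s"
    using singular_values_diagonalization[OF B] unfolding P_def s_def by blast
  note Vd = isometry_matD[OF V]
  have P: "P * P = mat_adjoint B * B" "P \<in> carrier_mat r r"
    unfolding P_def by (rule psd_sqrt_gram[OF B])+
  \<comment> \<open>Multiplication by \<open>J\<close> from the right selects the first \<open>p\<close> columns.\<close>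
  define J where "J = mat r p (\<lambda>(i, j). if i = j then 1 else 0 :: complex)"
  have Jd: "dim_row J = r" "dim_col J = p"
    by (auto simp: J_def)
  have JDJ: "mat_adjoint J * (real_diag r f * J) = real_diag p f" for f
  proof (rule eq_matI)
    fix i j assume "i < dim_row (real_diag p f)" "j < dim_col (real_diag p f)"
    then have ij: "i < p" "j < p" by auto
    have "(mat_adjoint J * (real_diag r f * J)) $$ (i, j)
        = (\<Sum>l<r. of_real (f l) * (cnj (J $$ (l, i)) * J $$ (l, j)))"
      using ij Jd by (intro conj_real_diag_index) auto
    also have "\<dots> = (\<Sum>l<r. if l = i then (if i = j then of_real (f i) else 0) else 0)"
      using ij p by (intro sum.cong) (auto simp: J_def)
    finally show "(mat_adjoint J * (real_diag r f * J)) $$ (i, j) = real_diag p f $$ (i, j)"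
      using ij p by simp
  qed (use Jd in auto)
  have "mat_adjoint J * J = 1\<^sub>m p"
    using JDJ[of "\<lambda>_. 1"] Jd by (simp add: real_diag_one carrier_matI[of J r p])
  then have J: "isometry_mat r p J"
    using Jd by (auto simp: isometry_mat_def)
  define F where "F = V * J"
  have F: "isometry_mat r p F"
    unfolding F_def by (rule isometry_mat_mult[OF V J])
  note Fd = isometry_matD(1-3)[OF F]
  have "mat_adjoint V * (P * (P * V)) = real_diag r (\<lambda>i. s i * s i)"
  proof -
    have "real_diag r s * real_diag r s = mat_adjoint V * (P * (V * (mat_adjoint V * (P * V))))"
      using Vd(1-3) P(2) by (simp add: mult_mat_assoc flip: D)
    also have "V * (mat_adjoint V * (P * V)) = P * V"
      using Vd P(2) unitary_right_inverse[OF V] by (intro mult_mat_cancel_left) auto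
    finally show ?thesis
      by (simp add: real_diag_mult)
  qed
  then have VBV: "mat_adjoint V * (mat_adjoint B * B) * V = real_diag r (\<lambda>i. s i * s i)"
    using Vd(1-3) P(2) by (simp add: mult_mat_assoc flip: P(1))
  have FBF: "mat_adjoint F * (mat_adjoint B * B) * F = real_diag p (\<lambda>i. s i * s i)"
    unfolding JDJ[of "\<lambda>i. s i * s i", symmetric] VBV[symmetric] F_def
    using Vd(1-3) B Jd by (simp add: mat_adjoint_mult mult_mat_assoc)
  have nz: "s i \<noteq> 0" if "i < p" for i
    using pos[OF that] by (simp add: s_def)
  let ?T = "real_diag p (\<lambda>i. 1 / s i)"
  define E where "E = B * F * ?T"
  have Ed: "E \<in> carrier_mat k p"
    using B Fd by (auto simp: E_def)
  have EBF: "mat_adjoint E * B * F = real_diag p s"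
  proof -
    have "mat_adjoint E * B * F = ?T * (mat_adjoint F * (mat_adjoint B * B) * F)"
      using Fd B by (simp add: E_def mat_adjoint_mult mult_mat_assoc)
    also have "\<dots> = real_diag p s"
      unfolding FBF real_diag_mult using nz by (intro real_diag_cong) simp
    finally show ?thesis .
  qed
  have "mat_adjoint E * E = mat_adjoint E * B * F * ?T"
    using Fd B Ed by (simp add: E_def mult_mat_assoc)
  also have "\<dots> = 1\<^sub>m p"
    unfolding EBF real_diag_mult real_diag_one[symmetric] using nz
    by (intro real_diag_cong) simp
  finally have "isometry_mat k p E"
    using Ed by (simp add: isometry_mat_def)
  then show ?thesis
    using that F EBF unfolding s_def by blast
qed

section \<open>Stacking two isometries\<close>

text \<open>The column \<open>(E, F)\<close>, written as a block matrix whose right blocks have no columns, so that the block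
product formula applies.\<close>

definition stack_mat :: "complex mat \<Rightarrow> complex mat \<Rightarrow> complex mat" where
  "stack_mat E F = four_block_mat E (0\<^sub>m (dim_row E) 0) F (0\<^sub>m (dim_row F) 0)"

lemma four_block_mat_empty:
  assumes "X \<in> carrier_mat n p"
  shows "four_block_mat X (0\<^sub>m n 0) (0\<^sub>m 0 p) (0\<^sub>m 0 0) = X"
  using assms by (intro eq_matI) auto

lemma stack_mat_carrier:
  assumes "E \<in> carrier_mat k p" "F \<in> carrier_mat r p"
  shows "stack_mat E F \<in> carrier_mat (k + r) p"
  using assms by (auto simp: stack_mat_def)

lemma adjoint_stack_mat:
  assumes "E \<in> carrier_mat k p" "F \<in> carrier_mat r p"
  shows "mat_adjoint (stack_mat E F)
       = four_block_mat (mat_adjoint E) (mat_adjoint F) (0\<^sub>m 0 k) (0\<^sub>m 0 r)"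
  unfolding stack_mat_def using assms by (subst mat_adjoint_four_block) auto

lemma row_mult_stack_mat:
  assumes E: "E \<in> carrier_mat k p" and F: "F \<in> carrier_mat r p"
    and P: "P \<in> carrier_mat q k" and Q: "Q \<in> carrier_mat q r"
  shows "four_block_mat P Q (0\<^sub>m 0 k) (0\<^sub>m 0 r) * stack_mat E F = P * E + Q * F"
proof -
  have "four_block_mat P Q (0\<^sub>m 0 k) (0\<^sub>m 0 r) * stack_mat E F
      = four_block_mat (P * E + Q * F) (0\<^sub>m q 0) (0\<^sub>m 0 p) (0\<^sub>m 0 0)"
    unfolding stack_mat_def using assms
    by (subst mult_four_block_mat[of _ q k _ r _ 0 _ _ p _ 0]) auto
  also have "\<dots> = P * E + Q * F"
    using assms by (intro four_block_mat_empty) auto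
  finally show ?thesis .
qed

lemma stack_mat_gram:
  assumes "E \<in> carrier_mat k p" "F \<in> carrier_mat r p"
  shows "mat_adjoint (stack_mat E F) * stack_mat E F
       = mat_adjoint E * E + mat_adjoint F * F"
  unfolding adjoint_stack_mat[OF assms] using assms by (intro row_mult_stack_mat) auto

lemma stack_mat_conj:
  assumes E: "E \<in> carrier_mat k p" and F: "F \<in> carrier_mat r p"
    and A: "A1 \<in> carrier_mat k k" "B \<in> carrier_mat k r" "C \<in> carrier_mat r k" "A2 \<in> carrier_mat r r"
  shows "mat_adjoint (stack_mat E F) * four_block_mat A1 B C A2 * stack_mat E F
       = (mat_adjoint E * A1 + mat_adjoint F * C) * E + (mat_adjoint E * B + mat_adjoint F * A2) * F"
proof -
  have "mat_adjoint (stack_mat E F) * four_block_mat A1 B C A2 * stack_mat E F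
      = four_block_mat (mat_adjoint E * A1 + mat_adjoint F * C) (mat_adjoint E * B + mat_adjoint F * A2)
          (0\<^sub>m 0 k) (0\<^sub>m 0 r) * stack_mat E F"
    unfolding adjoint_stack_mat[OF E F] using E F A
    by (subst mult_four_block_mat[of _ p k _ r _ 0 _ _ k _ r]) auto
  also have "\<dots> = (mat_adjoint E * A1 + mat_adjoint F * C) * E
      + (mat_adjoint E * B + mat_adjoint F * A2) * F"
    using E F A by (intro row_mult_stack_mat) auto
  finally show ?thesis .
qed

text \<open>The parameter \<open>\<epsilon> = \<plusminus>1\<close> selects the sign with which the second component enters.\<close>

lemma stack_isometry:
  assumes E: "isometry_mat k p E" and F: "isometry_mat r p F" and \<epsilon>: "\<epsilon>\<^sup>2 = (1 :: real)"
  defines "c \<equiv> complex_of_real (1 / sqrt 2)"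
  shows "isometry_mat (k + r) p (stack_mat (c \<cdot>\<^sub>m E) ((of_real \<epsilon> * c) \<cdot>\<^sub>m F))"
proof -
  note Ed = isometry_matD[OF E] and Fd = isometry_matD[OF F]
  have c: "cnj c = c" "c * c = 1 / 2"
    by (simp_all add: c_def flip: of_real_mult)
  have e: "of_real \<epsilon> * c * (of_real \<epsilon> * c) = 1 / 2"
  proof -
    have "of_real \<epsilon> * c * (of_real \<epsilon> * c) = of_real (\<epsilon>\<^sup>2) * (c * c)"
      by (simp add: power2_eq_square)
    then show ?thesis using \<epsilon> c by simp
  qed
  have "c * c + of_real \<epsilon> * c * (of_real \<epsilon> * c) = 1"
    unfolding c(2) e by simp
  then have tot: "c * c + of_real \<epsilon> * (c * (of_real \<epsilon> * c)) = 1"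
    by (simp only: mult.assoc)
  have "mat_adjoint (c \<cdot>\<^sub>m E) * (c \<cdot>\<^sub>m E) + mat_adjoint ((of_real \<epsilon> * c) \<cdot>\<^sub>m F) * ((of_real \<epsilon> * c) \<cdot>\<^sub>m F)
      = 1\<^sub>m p"
    using Ed Fd tot
    by (simp add: mat_adjoint_smult smult_mult_mat c(1)) (auto intro!: eq_matI simp: mult.assoc)
  then show ?thesis
    using Ed Fd stack_mat_gram[of "c \<cdot>\<^sub>m E" k p "(of_real \<epsilon> * c) \<cdot>\<^sub>m F" r]
      stack_mat_carrier[of "c \<cdot>\<^sub>m E" k p "(of_real \<epsilon> * c) \<cdot>\<^sub>m F" r]
    by (simp add: isometry_mat_def)
qed

text \<open>In the diagonal blocks the sign \<open>\<epsilon>\<close> occurs squared and disappears. The two off-diagonal blocks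
contribute complex conjugate numbers, each with factor \<open>\<epsilon> / 2\<close>, which the real part merges.\<close>

lemma stack_conj_diag:
  assumes E: "E \<in> carrier_mat k p" and F: "F \<in> carrier_mat r p"
    and A: "A1 \<in> carrier_mat k k" "B \<in> carrier_mat k r" "A2 \<in> carrier_mat r r"
    and \<epsilon>: "\<epsilon>\<^sup>2 = (1 :: real)" and i: "i < p"
  defines "c \<equiv> complex_of_real (1 / sqrt 2)"
  defines "W \<equiv> stack_mat (c \<cdot>\<^sub>m E) ((of_real \<epsilon> * c) \<cdot>\<^sub>m F)"
  shows "Re ((mat_adjoint W * four_block_mat A1 B (mat_adjoint B) A2 * W) $$ (i, i))
       = (Re ((mat_adjoint E * A1 * E) $$ (i, i)) + Re ((mat_adjoint F * A2 * F) $$ (i, i))) / 2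
         + \<epsilon> * Re ((mat_adjoint E * B * F) $$ (i, i))"
proof -
  let ?e = "complex_of_real \<epsilon>"
  have c: "cnj c = c" "c * c = 1 / 2" "?e * ?e = 1"
    using \<epsilon> by (simp_all add: c_def power2_eq_square flip: of_real_mult)
  have adj: "(mat_adjoint F * mat_adjoint B * E) $$ (i, i) = cnj ((mat_adjoint E * B * F) $$ (i, i))"
  proof -
    have "mat_adjoint F * mat_adjoint B * E = mat_adjoint (mat_adjoint E * B * F)"
      using E F A by (simp add: mat_adjoint_mult mult_mat_assoc)
    then show ?thesis
      using E F i by (simp add: mat_adjoint_index del: index_mult_mat(1))
  qed
  have "mat_adjoint W * four_block_mat A1 B (mat_adjoint B) A2 * W
      = (mat_adjoint (c \<cdot>\<^sub>m E) * A1 + mat_adjoint ((?e * c) \<cdot>\<^sub>m F) * mat_adjoint B) * (c \<cdot>\<^sub>m E)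
      + (mat_adjoint (c \<cdot>\<^sub>m E) * B + mat_adjoint ((?e * c) \<cdot>\<^sub>m F) * A2) * ((?e * c) \<cdot>\<^sub>m F)"
    unfolding W_def using E F A by (intro stack_mat_conj) auto
  also have "\<dots> $$ (i, i)
      = c * c * (mat_adjoint E * A1 * E) $$ (i, i)
      + ?e * (c * c) * (mat_adjoint F * mat_adjoint B * E) $$ (i, i)
      + ?e * (c * c) * (mat_adjoint E * B * F) $$ (i, i)
      + (?e * ?e) * (c * c) * (mat_adjoint F * A2 * F) $$ (i, i)"
  proof -
    have *: "dim_row E = k" "dim_col E = p" "dim_row F = r" "dim_col F = p" "dim_row A1 = k"
      "dim_col A1 = k" "dim_row B = k" "dim_col B = r" "dim_row A2 = r" "dim_col A2 = r"
      using E F A by auto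
    have add: "(X + Y) * Z = X * Z + Y * Z"
      if "dim_row X = dim_row Y" "dim_col X = dim_col Y" "dim_row Z = dim_col X" for X Y Z :: "complex mat"
      using that by (intro add_mult_distrib_mat[of _ "dim_row X" "dim_col X" _ _ "dim_col Z"]) auto
    show ?thesis
      using i by (simp add: * add mat_adjoint_smult smult_mult_mat c(1) algebra_simps del: index_mult_mat(1))
  qed
  finally have "(mat_adjoint W * four_block_mat A1 B (mat_adjoint B) A2 * W) $$ (i, i)
      = 1 / 2 * (mat_adjoint E * A1 * E) $$ (i, i)
      + ?e * (1 / 2) * cnj ((mat_adjoint E * B * F) $$ (i, i))
      + ?e * (1 / 2) * (mat_adjoint E * B * F) $$ (i, i)
      + 1 * (1 / 2) * (mat_adjoint F * A2 * F) $$ (i, i)"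
    unfolding c adj .
  then show ?thesis
    by (simp del: index_mult_mat(1))
qed

text \<open>With \<open>W \<epsilon>\<close> the stacked isometry for the sign \<open>\<epsilon>\<close> and singular vectors \<open>E\<close>, \<open>F\<close>, the traces
\<open>\<tau> 1\<close> and \<open>\<tau> (-1)\<close> of the two compressions of \<open>A\<close> differ by twice the sum of the singular values.
The first is at most the sum of the \<open>p\<close> largest eigenvalues, the second at least the sum of the \<open>p\<close>
smallest ones.\<close>

lemma sum_singular_values_le_spread:
  assumes "A1 \<in> carrier_mat k k" "A2 \<in> carrier_mat r r" and B: "B \<in> carrier_mat k r"
    and A: "A = four_block_mat A1 B (mat_adjoint B) A2" and h: "hermitian A"
    and p: "p \<le> r" and pos: "\<And>i. i < p \<Longrightarrow> 0 < singular_values B ! i"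
  shows "p \<le> k"
    and "2 * (\<Sum>i<p. singular_values B ! i)
       \<le> (\<Sum>i<p. eigvals_desc A ! i - eigvals_desc A ! (k + r - 1 - i))"
proof -
  obtain E F where E: "isometry_mat k p E" and F: "isometry_mat r p F"
    and s: "mat_adjoint E * B * F = real_diag p ((!) (singular_values B))"
    using singular_vectors[OF B p pos] by blast
  show "p \<le> k"
    by (rule isometry_dim_le[OF E])
  define c where "c = complex_of_real (1 / sqrt 2)"
  define W where "W \<epsilon> = stack_mat (c \<cdot>\<^sub>m E) ((of_real \<epsilon> * c) \<cdot>\<^sub>m F)" for \<epsilon> :: real
  define \<tau> where "\<tau> \<epsilon> = (\<Sum>i<p. Re ((mat_adjoint (W \<epsilon>) * A * W \<epsilon>) $$ (i, i)))" for \<epsilon>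
  define a where "a i = (Re ((mat_adjoint E * A1 * E) $$ (i, i))
      + Re ((mat_adjoint F * A2 * F) $$ (i, i))) / 2" for i
  have iso: "isometry_mat (k + r) p (W \<epsilon>)" if "\<epsilon>\<^sup>2 = 1" for \<epsilon>
    unfolding W_def c_def by (rule stack_isometry[OF E F that])
  have \<tau>: "\<tau> \<epsilon> = (\<Sum>i<p. a i + \<epsilon> * singular_values B ! i)" if "\<epsilon>\<^sup>2 = 1" for \<epsilon>
    unfolding \<tau>_def
  proof (intro sum.cong refl)
    fix i assume "i \<in> {..<p}"
    then show "Re ((mat_adjoint (W \<epsilon>) * A * W \<epsilon>) $$ (i, i)) = a i + \<epsilon> * singular_values B ! i"
      unfolding W_def c_def A a_def
      using stack_conj_diag[OF isometry_matD(1)[OF E] isometry_matD(1)[OF F] assms(1) B assms(2) that, of i] s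
      by simp
  qed
  have Ac: "A \<in> carrier_mat (k + r) (k + r)"
    using assms(1,2) by (simp add: A)
  have "2 * (\<Sum>i<p. singular_values B ! i) = \<tau> 1 - \<tau> (-1)"
    by (simp add: \<tau> sum.distrib sum_subtractf)
  also have "\<dots> \<le> (\<Sum>i<p. eigvals_desc A ! i) - (\<Sum>i<p. eigvals_desc A ! (k + r - 1 - i))"
    unfolding \<tau>_def by (intro diff_mono Ky_Fan_bounds[OF Ac h] iso) simp_all
  finally show "2 * (\<Sum>i<p. singular_values B ! i)
      \<le> (\<Sum>i<p. eigvals_desc A ! i - eigvals_desc A ! (k + r - 1 - i))"
    by (simp add: sum_subtractf)
qed

section \<open>Submajorization\<close>

lemma rev_sort_antimono:
  fixes xs :: "real list"
  assumes "\<And>i j. i \<le> j \<Longrightarrow> j < length xs \<Longrightarrow> xs ! j \<le> xs ! i"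
  shows "rev (sort xs) = xs"
proof -
  have "sorted (rev xs)"
    unfolding sorted_iff_nth_mono using assms by (auto simp: rev_nth)
  then have "sort xs = rev xs"
    by (intro properties_for_sort) auto
  then show ?thesis by simp
qed

text \<open>For sorted non-negative lists it suffices to compare initial sums over strictly positive entries of
\<open>x\<close>: further entries of \<open>x\<close> are zero, while further entries of \<open>y\<close>, padded by zeros, can only
increase the right-hand side.\<close>

lemma submajorizedI:
  fixes x y :: "real list"
  assumes x: "\<And>i j. i \<le> j \<Longrightarrow> j < length x \<Longrightarrow> x ! j \<le> x ! i" "\<And>i. i < length x \<Longrightarrow> 0 \<le> x ! i"
    and y: "\<And>i j. i \<le> j \<Longrightarrow> j < length y \<Longrightarrow> y ! j \<le> y ! i" "\<And>i. i < length y \<Longrightarrow> 0 \<le> y ! i"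
    and le: "\<And>p. p \<le> length x \<Longrightarrow> (\<And>i. i < p \<Longrightarrow> 0 < x ! i)
          \<Longrightarrow> p \<le> length y \<and> (\<Sum>i<p. x ! i) \<le> (\<Sum>i<p. y ! i)"
  shows "x \<prec>\<^sub>w y"
proof -
  define m where "m = max (length x) (length y)"
  have pad_nth: "pad_zeros m z ! i = (if i < length z then z ! i else 0)"
    if "i < m" for z :: "real list" and i
    using that by (auto simp: pad_zeros_def nth_append)
  have len: "length (pad_zeros m x) = m" "length (pad_zeros m y) = m"
    by (auto simp: pad_zeros_def m_def)
  have sx: "rev (sort (pad_zeros m x)) = pad_zeros m x"
    using x by (intro rev_sort_antimono) (auto simp: len pad_nth)
  have sy: "rev (sort (pad_zeros m y)) = pad_zeros m y"
    using y by (intro rev_sort_antimono) (auto simp: len pad_nth)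
  have "(\<Sum>i<j. pad_zeros m x ! i) \<le> (\<Sum>i<j. pad_zeros m y ! i)" if j: "j \<le> m" for j
  proof -
    \<comment> \<open>The number of positive entries among the first \<open>j\<close>.\<close>
    define p where "p = (LEAST i. \<not> (i < j \<and> i < length x \<and> 0 < x ! i))"
    have p: "\<not> (p < j \<and> p < length x \<and> 0 < x ! p)"
      unfolding p_def by (rule LeastI[of _ j]) simp
    have below: "i < j \<and> i < length x \<and> 0 < x ! i" if "i < p" for i
      using not_less_Least[of i "\<lambda>i. \<not> (i < j \<and> i < length x \<and> 0 < x ! i)"] that
      by (simp add: p_def)
    have pj: "p \<le> j" and px: "p \<le> length x"
      using below by (meson less_irrefl not_le)+
    have py: "p \<le> length y" and sum: "(\<Sum>i<p. x ! i) \<le> (\<Sum>i<p. y ! i)"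
      using le[OF px] below by auto
    have tail: "x ! i = 0" if "p \<le> i" "i < j" "i < length x" for i
      using x(1)[of p i] x(2)[of i] that p by (simp add: not_less)
    have "(\<Sum>i<j. pad_zeros m x ! i) = (\<Sum>i<p. x ! i)"
      using j pj below tail by (intro sum.mono_neutral_cong_right) (auto simp: pad_nth)
    also note sum
    also have "(\<Sum>i<p. y ! i) = (\<Sum>i<p. pad_zeros m y ! i)"
      using j pj py by (intro sum.cong) (auto simp: pad_nth)
    also have "\<dots> \<le> (\<Sum>i<j. pad_zeros m y ! i)"
      using j pj y(2) by (intro sum_mono2) (auto simp: pad_nth)
    finally show ?thesis .
  qed
  then show ?thesis
    unfolding submajorized_def Let_def m_def[symmetric] sx sy by blast
qed

theorem theorem2p7:
  fixes k r :: nat and A A1 A2 B :: "complex mat"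
  assumes "k \<ge> 1" and "r \<ge> 1"
    and "A1 \<in> carrier_mat k k"
    and "A2 \<in> carrier_mat r r"
    and "B \<in> carrier_mat k r"
    and "A = four_block_mat A1 B (mat_adjoint B) A2"
    and "hermitian A"
  shows "map ((*) 2) (singular_values B) \<prec>\<^sub>w spectral_spread A"
proof -
  note B = assms(5)
  let ?s = "singular_values B" and ?l = "eigvals_desc A" and ?n = "k + r"
  have A: "A \<in> carrier_mat ?n ?n"
    using assms(3,4,6) by simp
  have ls: "length ?s = r"
    unfolding singular_values_def by (rule length_eigvals_desc[OF psd_sqrt_gram(3)[OF B]])
  have ll: "length ?l = ?n"
    by (rule length_eigvals_desc[OF A])
  have spread: "length (spectral_spread A) = ?n div 2"
    "\<And>i. i < ?n div 2 \<Longrightarrow> spectral_spread A ! i = ?l ! i - ?l ! (?n - 1 - i)"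
    using A by (auto simp: spectral_spread_def Let_def)
  have anti: "?l ! j \<le> ?l ! i" if "i \<le> j" "j < ?n" for i j
    using that ll by (intro eigvals_desc_antimono) auto
  show ?thesis
  proof (rule submajorizedI)
    fix i j assume "i \<le> j" "j < length (map ((*) 2) ?s)"
    then show "map ((*) 2) ?s ! j \<le> map ((*) 2) ?s ! i"
      by (simp add: singular_values_def eigvals_desc_antimono)
  next
    fix i assume "i < length (map ((*) 2) ?s)"
    then show "0 \<le> map ((*) 2) ?s ! i"
      using singular_values_nonneg[OF B] ls by simp
  next
    fix i j assume "i \<le> j" "j < length (spectral_spread A)"
    then show "spectral_spread A ! j \<le> spectral_spread A ! i"
      using anti[of i j] anti[of "?n - 1 - j" "?n - 1 - i"] by (simp add: spread diff_mono)
  next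
    fix i assume "i < length (spectral_spread A)"
    then show "0 \<le> spectral_spread A ! i"
      using anti[of i "?n - 1 - i"] by (simp add: spread)
  next
    fix p assume p: "p \<le> length (map ((*) 2) ?s)"
      and "\<And>i. i < p \<Longrightarrow> 0 < map ((*) 2) ?s ! i"
    then have pos: "0 < ?s ! i" if "i < p" for i
      using that by fastforce
    have pr: "p \<le> r"
      using p ls by simp
    note main = sum_singular_values_le_spread[OF assms(3,4) B assms(6,7) pr pos]
    \<comment> \<open>Positivity of \<open>p\<close> singular values forces \<open>p \<le> k\<close>, hence \<open>2 * p \<le> k + r\<close>.\<close>
    have ph: "p \<le> ?n div 2"
      using main(1) pr by simp
    have "(\<Sum>i<p. map ((*) 2) ?s ! i) = 2 * (\<Sum>i<p. ?s ! i)"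
      using p by (simp add: sum_distrib_left)
    also have "\<dots> \<le> (\<Sum>i<p. ?l ! i - ?l ! (?n - 1 - i))"
      by (rule main(2))
    also have "\<dots> = (\<Sum>i<p. spectral_spread A ! i)"
      using ph by (intro sum.cong) (auto simp: spread)
    finally show "p \<le> length (spectral_spread A)
        \<and> (\<Sum>i<p. map ((*) 2) ?s ! i) \<le> (\<Sum>i<p. spectral_spread A ! i)"
      using ph by (simp add: spread)
  qed
qed

end
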